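(* Let $k \geq 3$ be an integer. Let $(a_i)_{i \in \mathbf{N}}$ be a strictly decreasing infinite sequence of positive real numbers such that \[ G = \bigcup_{i=1}^{\infty} (a_{2i}, a_{2i-1}] \] is a $k$-good set, and \[ \operatorname{Bad}(G) = \bigcup_{i=1}^{\infty} (a_{2i+1}, a_{2i}]. \] If $A_1$ and $A_2$ are positive integers such that $a_1 = 1/A_1$ and $a_2 = 1/A_2$, then there is a strictly increasing infinite sequence $(A_i)_{i \in \mathbf{N}}$ of positive integers (extending $A_1, A_2$) such that \[ a_i = \frac{1}{A_i} \] for all $i \in \mathbf{N}$. Moreover, \[ \lim_{i \to \infty} a_i = 0. \]
   Context: Here $\mathbf{N} = \{1,2,3,\ldots\}$, $(u,v] = \{x \in \mathbf{R} : u < x \leq v\}$, and $k \geq 3$ is a fixed integer. A geometric progression of length $k$ with integer ratio is a sequence $(a, ar, ar^2, \ldots, ar^{k-1})$ with $a$ a positive real number and $r \geq 2$ an integer. A set of positive real numbers is $k$-good if it contains no geometric progression of length $k$ with integer ratio. For a $k$-good set $G \subseteq (0,1]$, a number $x \in (0,1] \setminus G$ is $k$-bad with respect to $G$ if there exists an integer $r \geq 2$ such that $G \cup \{x\}$ contains $x, xr, xr^2, \ldots, xr^{k-1}$ (equivalently, $xr^j \in G$ for all $j \in \{1, \ldots, k-1\}$). Define $\operatorname{Bad}(G) = \{x \in (0,1] \setminus G : x \text{ is } k\text{-bad with respect to } G\}$. (Since $a_1 = 1/A_1 \leq 1$, the set $G$ in the claim is contained in $(0,1]$.) *)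

theory Defs
  imports Complex_Main
begin

definition geom_prog :: "nat \<Rightarrow> real \<Rightarrow> nat \<Rightarrow> real set"
  where "geom_prog k a r = (\<lambda>j. a * real r ^ j) ` {..<k}"

definition k_good :: "nat \<Rightarrow> real set \<Rightarrow> bool"
  where "k_good k S \<longleftrightarrow> S \<subseteq> {0<..} \<and>
    \<not> (\<exists>a r. a > 0 \<and> r \<ge> 2 \<and> geom_prog k a r \<subseteq> S)"

definition k_bad :: "nat \<Rightarrow> real set \<Rightarrow> real \<Rightarrow> bool"
  where "k_bad k G x \<longleftrightarrow> (\<exists>r\<ge>2. geom_prog k x r \<subseteq> G \<union> {x})"

text \<open>Only meaningful for a \<open>k\<close>-good set \<open>G \<subseteq> {0<..1}\<close>.\<close>

definition Bad :: "nat \<Rightarrow> real set \<Rightarrow> real set"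
  where "Bad k G = {x \<in> {0<..1} - G. k_bad k G x}"

end

theory Submission
  imports Defs
begin

text \<open>
  The idea is to compare an endpoint \<open>t = a n\<close>, \<open>n \<ge> 2\<close>, with points \<open>x\<close> slightly to its right.
  One of \<open>t\<close> and \<open>x\<close> lies in \<open>G\<close>, the other in \<open>Bad k G\<close>, because the half-open intervals of the two
  unions alternate and meet at \<open>t\<close>. The two sets are told apart by the property that some
  \<open>r \<ge> 2\<close> has \<open>y * r ^ j \<in> G\<close> for \<open>1 \<le> j < k\<close>: it holds for \<open>y\<close> in \<open>Bad k G\<close>, and fails for
  \<open>y\<close> in \<open>G\<close> since \<open>G\<close> is good. It depends only on which multiples \<open>y * N\<close>, \<open>N \<ge> 2\<close>, lie in
  \<open>G\<close>. For \<open>y \<ge> t\<close> these multiples lie to the right of \<open>t\<close>, where only the endpoints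
  \<open>a m\<close> with \<open>m < n\<close> matter. If no multiple \<open>t * N\<close> were equal to such an \<open>a m\<close>, then passing from \<open>t\<close> to a sufficiently close \<open>x > t\<close> would carry no multiple
  across an endpoint, and the property could not distinguish \<open>t\<close> from \<open>x\<close>. Hence
  \<open>a n * N = a m\<close> for some \<open>m < n\<close> and some integer \<open>N \<ge> 2\<close> (lemma \<open>endpoint_multiple_is_endpoint\<close>).

  Strong induction starting from \<open>a 1 = 1 / A1\<close> now makes every \<open>a n\<close> the reciprocal of a positive
  integer. These integers increase strictly, so the \<open>n\<close>-th is at least \<open>n\<close>, and \<open>a n\<close> tends to 0.
\<close>

text \<open>
  All but finitely many of the multiples \<open>t * N\<close> already exceed \<open>b\<close>, and moving \<open>t\<close> to the right
  keeps them there; the others are strictly below \<open>b\<close> and, being finite in number, stay there under small moves.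
\<close>

lemma eventually_multiples_on_same_side:
  fixes t b :: real
  assumes "t > 0" and "\<And>N::nat. N \<ge> 2 \<Longrightarrow> t * real N \<noteq> b"
  shows "\<forall>\<^sub>F x in at_right t. \<forall>N::nat. N \<ge> 2 \<longrightarrow> (b < x * real N \<longleftrightarrow> b < t * real N)"
proof -
  obtain M :: nat where M: "b < t * real M"
    using reals_Archimedean3[OF \<open>t > 0\<close>] by (metis mult.commute)
  have "\<forall>\<^sub>F x in at_right t. t * real N < b \<longrightarrow> x * real N < b" for N :: nat
  proof (cases "t * real N < b")
    case True
    have "((\<lambda>x. x * real N) \<longlongrightarrow> t * real N) (at_right t)"
      by (intro tendsto_intros)
    then show ?thesis
      using order_tendstoD(2)[OF _ True] by (auto elim: eventually_mono)
  qed simp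
  then have "\<forall>\<^sub>F x in at_right t. \<forall>N\<in>{..<M}. t * real N < b \<longrightarrow> x * real N < b"
    by (intro eventually_ball_finite) auto
  moreover have "\<forall>\<^sub>F x in at_right t. t < x"
    by (rule eventually_at_right_less)
  ultimately show ?thesis
  proof eventually_elim
    case (elim x)
    show ?case
    proof (intro allI impI)
      fix N :: nat
      assume "N \<ge> 2"
      have le: "t * real N \<le> x * real N"
        using elim(2) by (intro mult_right_mono) auto
      show "b < x * real N \<longleftrightarrow> b < t * real N"
      proof (cases "N < M")
        case True
        then show ?thesis
          using elim(1)[rule_format, of N] le assms(2)[OF \<open>N \<ge> 2\<close>] by (simp, linarith)
      next
        case False
        then have "t * real M \<le> t * real N"
          using \<open>t > 0\<close> by (intro mult_left_mono) auto
        then show ?thesis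
          using M le by linarith
      qed
    qed
  qed
qed

lemma k_bad_imp_multiples:
  assumes "k_bad k G x" and "x > 0"
  shows "\<exists>r\<ge>2. \<forall>j\<in>{1..<k}. x * real (r ^ j) \<in> G"
proof -
  obtain r where r: "r \<ge> 2" "geom_prog k x r \<subseteq> G \<union> {x}"
    using assms(1) by (auto simp: k_bad_def)
  have "x * real (r ^ j) \<in> G" if "j \<in> {1..<k}" for j
  proof -
    have "real r ^ j > 1"
      using r(1) that by (intro one_less_power) auto
    then have "x * real r ^ j \<noteq> x"
      using \<open>x > 0\<close> by auto
    moreover have "x * real r ^ j \<in> geom_prog k x r"
      using that by (auto simp: geom_prog_def)
    ultimately show ?thesis
      using r(2) by auto
  qed
  then show ?thesis
    using r(1) by blast
qed

lemma k_good_imp_no_multiples: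
  assumes "k_good k G" and "x \<in> G"
  shows "\<not> (\<exists>r\<ge>2. \<forall>j\<in>{1..<k}. x * real (r ^ j) \<in> G)"
proof
  assume "\<exists>r\<ge>2. \<forall>j\<in>{1..<k}. x * real (r ^ j) \<in> G"
  then obtain r where r: "r \<ge> 2" "\<And>j. j \<in> {1..<k} \<Longrightarrow> x * real (r ^ j) \<in> G"
    by blast
  have "x * real r ^ j \<in> G" if "j < k" for j
    using r(2)[of j] that \<open>x \<in> G\<close> by (cases "j = 0") auto
  then have "geom_prog k x r \<subseteq> G"
    by (auto simp: geom_prog_def)
  moreover have "x > 0"
    using assms by (auto simp: k_good_def)
  ultimately show False
    using assms(1) r(1) by (auto simp: k_good_def)
qed

text \<open>
  An interval with upper endpoint \<open>a (2 * i - 1) \<le> a n\<close> has no point to the right of \<open>a n\<close>; in any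
  other interval both endpoints are among \<open>a 1, \<dots>, a n\<close>, and \<open>a n\<close> itself is below \<open>y\<close> and \<open>z\<close>.
\<close>

lemma alternating_union_mem_cong:
  fixes a :: "nat \<Rightarrow> real"
  assumes anti: "strict_antimono_on {1..} a" and "n \<ge> 1"
    and "a n < y" and "a n < z"
    and same: "\<And>m. m \<in> {1..<n} \<Longrightarrow> a m < y \<longleftrightarrow> a m < z"
  shows "y \<in> (\<Union>i\<in>{1..}. {a (2 * i)<..a (2 * i - 1)}) \<longleftrightarrow>
         z \<in> (\<Union>i\<in>{1..}. {a (2 * i)<..a (2 * i - 1)})"
proof -
  have "y \<in> {a (2 * i)<..a (2 * i - 1)} \<longleftrightarrow> z \<in> {a (2 * i)<..a (2 * i - 1)}" if "i \<ge> 1" for i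
  proof (cases "2 * i - 1 < n")
    case True
    then have "2 * i \<in> {1..<n} \<or> 2 * i = n"
      using that by auto
    then have "a (2 * i) < y \<longleftrightarrow> a (2 * i) < z"
      using same assms(3,4) by blast
    moreover have "y \<le> a (2 * i - 1) \<longleftrightarrow> z \<le> a (2 * i - 1)"
      using same[of "2 * i - 1"] that True by (simp flip: not_less)
    ultimately show ?thesis
      by auto
  next
    case False
    then have "a (2 * i - 1) \<le> a n"
      using monotone_onD[OF anti, of n "2 * i - 1"] \<open>n \<ge> 1\<close>
      by (cases "2 * i - 1 = n") auto
    then show ?thesis
      using assms(3,4) by auto
  qed
  then show ?thesis
    by auto
qed

text \<open>
  Otherwise a point \<open>x\<close> just to the right of \<open>a n\<close> would have its multiples distributed over \<open>G\<close> in
  the same way as \<open>a n\<close>, although one of the two points lies in \<open>G\<close> and the other is bad.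
\<close>

lemma endpoint_multiple_is_endpoint:
  fixes a :: "nat \<Rightarrow> real"
  assumes pos: "\<And>i. i \<ge> 1 \<Longrightarrow> a i > 0"
    and anti: "strict_antimono_on {1..} a"
    and G: "G = (\<Union>i\<in>{1..}. {a (2 * i)<..a (2 * i - 1)})"
    and good: "k_good k G"
    and Bad: "Bad k G = (\<Union>i\<in>{1..}. {a (2 * i + 1)<..a (2 * i)})"
    and "n \<ge> 2"
  shows "\<exists>m\<in>{1..<n}. \<exists>N::nat\<ge>2. a n * real N = a m"
proof (rule ccontr)
  assume "\<not> ?thesis"
  then have ne: "a n * real N \<noteq> a m" if "m \<in> {1..<n}" "N \<ge> 2" for m N
    using that by blast
  have less: "a j < a i" if "1 \<le> i" "i < j" for i j
    using monotone_onD[OF anti, of i j] that by auto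
  have "a n > 0"
    using pos \<open>n \<ge> 2\<close> by simp
  have "a n < a (n - 1)"
    using \<open>n \<ge> 2\<close> by (intro less) auto
  have "\<forall>\<^sub>F x in at_right (a n). \<forall>m\<in>{1..<n}. \<forall>N::nat. N \<ge> 2 \<longrightarrow>
          (a m < x * real N \<longleftrightarrow> a m < a n * real N)"
    using eventually_multiples_on_same_side[OF \<open>a n > 0\<close> ne]
    by (intro eventually_ball_finite) auto
  moreover have "\<forall>\<^sub>F x in at_right (a n). x \<in> {a n<..<a (n - 1)}"
    using \<open>a n < a (n - 1)\<close> by (rule eventually_at_right_real)
  ultimately have "\<forall>\<^sub>F x in at_right (a n). x \<in> {a n<..<a (n - 1)} \<and>
      (\<forall>m\<in>{1..<n}. \<forall>N::nat. N \<ge> 2 \<longrightarrow> (a m < x * real N \<longleftrightarrow> a m < a n * real N))"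
    by eventually_elim blast
  then obtain x where x: "a n < x" "x < a (n - 1)"
    and side: "\<And>m N::nat. m \<in> {1..<n} \<Longrightarrow> N \<ge> 2 \<Longrightarrow> a m < x * real N \<longleftrightarrow> a m < a n * real N"
    using eventually_happens'[OF trivial_limit_at_right_real] by fastforce
  \<comment> \<open>Since \<open>N \<ge> 2\<close>, both multiples exceed \<open>a n\<close>, so \<open>a 1, \<dots>, a (n - 1)\<close> decide their membership.\<close>
  have mult: "x * real N \<in> G \<longleftrightarrow> a n * real N \<in> G" if "N \<ge> 2" for N
  proof -
    have gt: "y < y * real N" if "y > 0" for y :: real
      using that \<open>N \<ge> 2\<close> by simp
    show ?thesis
      unfolding G
    proof (rule alternating_union_mem_cong[OF anti, of n])
      show "a n < a n * real N" "a n < x * real N"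
        using gt[of "a n"] gt[of x] \<open>a n > 0\<close> x(1) by linarith+
    qed (use side \<open>N \<ge> 2\<close> \<open>n \<ge> 2\<close> in auto)
  qed
  have mult': "(\<exists>r\<ge>2. \<forall>j\<in>{1..<k}. x * real (r ^ j) \<in> G) \<longleftrightarrow>
               (\<exists>r\<ge>2. \<forall>j\<in>{1..<k}. a n * real (r ^ j) \<in> G)"
  proof -
    have "r ^ j \<ge> 2" if "r \<ge> 2" "j \<in> {1..<k}" for r j :: nat
      using that self_le_power[of r j] by force
    then show ?thesis
      using mult by blast
  qed
  have bad: "\<exists>r\<ge>2. \<forall>j\<in>{1..<k}. y * real (r ^ j) \<in> G" if "y \<in> Bad k G" for y
    using that by (intro k_bad_imp_multiples) (auto simp: Bad_def)
  show False
  proof (cases "even n")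
    case True
    then obtain i where i: "n = 2 * i"
      by blast
    then have "i \<ge> 1"
      using \<open>n \<ge> 2\<close> by simp
    have "x \<in> G"
      unfolding G using x i \<open>i \<ge> 1\<close> by (intro UN_I[of i]) auto
    moreover have "a n \<in> Bad k G"
      unfolding Bad using less[of n "n + 1"] i \<open>i \<ge> 1\<close> by (intro UN_I[of i]) auto
    ultimately show False
      using bad mult' k_good_imp_no_multiples[OF good] by blast
  next
    case False
    then obtain i where i: "n = 2 * i + 1"
      by (elim oddE)
    then have "i \<ge> 1"
      using \<open>n \<ge> 2\<close> by simp
    have "x \<in> Bad k G"
      unfolding Bad using x i \<open>i \<ge> 1\<close> by (intro UN_I[of i]) auto
    moreover have "a n \<in> G"
      unfolding G using less[of n "n + 1"] i \<open>i \<ge> 1\<close> by (intro UN_I[of "i + 1"]) auto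
    ultimately show False
      using bad mult' k_good_imp_no_multiples[OF good] by blast
  qed
qed

theorem theorem4:
  fixes k :: nat and a :: "nat \<Rightarrow> real" and G :: "real set" and A1 A2 :: nat
  assumes "k \<ge> 3"
    and "\<And>i. i \<ge> 1 \<Longrightarrow> a i > 0"
    and "strict_antimono_on {1..} a"
    and "G = (\<Union>i\<in>{1..}. {a (2 * i)<..a (2 * i - 1)})"
    and "k_good k G"
    and "Bad k G = (\<Union>i\<in>{1..}. {a (2 * i + 1)<..a (2 * i)})"
    and "A1 > 0" and "A2 > 0"
    and "a 1 = 1 / real A1" and "a 2 = 1 / real A2"
  shows "(\<exists>A :: nat \<Rightarrow> nat. A 1 = A1 \<and> A 2 = A2 \<and> strict_mono_on {1..} A \<and>
            (\<forall>i\<ge>1. A i > 0 \<and> a i = 1 / real (A i))) \<and>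
         a \<longlonglongrightarrow> 0"
proof -
  have "\<exists>c::nat. c > 0 \<and> a i = 1 / real c" if "i \<ge> 1" for i
    using that
  proof (induction i rule: less_induct)
    case (less n)
    show ?case
    proof (cases "n = 1")
      case True
      then show ?thesis
        using assms(7,9) by blast
    next
      case False
      then have "n \<ge> 2"
        using less.prems by simp
      then obtain m N where m: "m \<in> {1..<n}" and N: "N \<ge> 2" "a n * real N = a m"
        using endpoint_multiple_is_endpoint[OF assms(2-6)] by blast
      obtain c :: nat where c: "c > 0" "a m = 1 / real c"
        using less.IH[of m] m by auto
      have "a n = 1 / real (c * N)"
        using N c by (simp add: field_simps)
      then show ?thesis
        using c N by (intro exI[of _ "c * N"]) auto
    qed
  qed
  then obtain A :: "nat \<Rightarrow> nat" where A: "\<And>i. i \<ge> 1 \<Longrightarrow> A i > 0 \<and> a i = 1 / real (A i)"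
    by metis
  have A12: "A 1 = A1" "A 2 = A2"
    using A[of 1] A[of 2] assms(7-10) by auto
  have A_less: "A i < A j" if "1 \<le> i" "i < j" for i j
  proof -
    have "a j < a i"
      using monotone_onD[OF assms(3), of i j] that by auto
    then show ?thesis
      using A[of i] A[of j] that by (auto simp: field_simps)
  qed
  then have mono: "strict_mono_on {1..} A"
    by (auto intro: strict_mono_onI)
  have A_ge: "i \<le> A i" if "i \<ge> 1" for i
    using that
  proof (induction i rule: dec_induct)
    case base
    then show ?case
      using A[of 1] by auto
  next
    case (step i)
    then show ?case
      using A_less[of i "Suc i"] by auto
  qed
  have "a \<longlonglongrightarrow> 0"
  proof (rule tendsto_sandwich[OF _ _ tendsto_const lim_1_over_n])
    show "\<forall>\<^sub>F i in sequentially. 0 \<le> a i"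
      using eventually_ge_at_top[of 1] by eventually_elim (use assms(2) in \<open>auto intro: less_imp_le\<close>)
    show "\<forall>\<^sub>F i in sequentially. a i \<le> 1 / real i"
      using eventually_ge_at_top[of 1]
    proof eventually_elim
      case (elim i)
      then show ?case
        using A[of i] A_ge[of i] by (auto intro!: divide_left_mono)
    qed
  qed
  then show ?thesis
    using A A12 mono by blast
qed

end
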